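(* Let $K$ be a field of characteristic $0$, let $m,d,r_1,\ldots,r_d,n\ge1$ be integers and put $\rho=\sum_{j=1}^d r_j$. Let $\alpha_1,\ldots,\alpha_m\in K\setminus\{0\}$ be pairwise distinct, and let $x_1,\ldots,x_d\in\mathbb{Q}$, where no $x_j$ is a negative integer and $x_i-x_j\notin\mathbb{Z}$ for $i\neq j$. For $0\le l\le\rho m$ let $\boldsymbol{p}_l(z)\in K[z]^{\rho m+1}$ be the column vector whose first entry is $P_l(z)$ and whose remaining $\rho m$ entries are the polynomials $P_{l,i,j,s_j}(z)$ ($1\le i\le m$, $1\le j\le d$, $1\le s_j\le r_j$), listed in a fixed order independent of $l$, where $P_l$ and $P_{l,i,j,s_j}$ are the polynomials defined in the context. Then $$\Delta(z)=\det\left(\boldsymbol{p}_0(z),\ldots,\boldsymbol{p}_{\rho m}(z)\right)\in K\setminus\{0\},$$ that is, the determinant is a nonzero constant.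
   Context: For $x\in\mathbb{Q}$ not a negative integer and $n\ge0$, $S_{n,x}:K[t]\to K[t]$ is the $K$-linear map with $S_{n,x}(t^k)=\frac{(k+x+1)(k+x+2)\cdots(k+x+n)}{n!}t^k$ (these maps commute). $S_{n,x}^{(r)}$ denotes the $r$-fold composition. For $\alpha\in K$ and $s\ge0$, $\varphi_{\alpha,x,s}:K[t]\to K$ is the $K$-linear map $t^k\mapsto \frac{\alpha^{k+1}}{(k+x+1)^s}$; it is extended $K[z]$-linearly to $K[z][t]\to K[z]$. For $0\le l\le\rho m$ put $A_l(t)=t^l\prod_{i=1}^m(t-\alpha_i)^{\rho n}$, let $P_l(t)=S_{n,x_1}^{(r_1)}\circ\cdots\circ S_{n,x_d}^{(r_d)}(A_l(t))$ (and $P_l(z)$ the same polynomial in $z$), and $$P_{l,i,j,s_j}(z)=\varphi_{\alpha_i,x_j,s_j}\left(\frac{P_l(z)-P_l(t)}{z-t}\right),\qquad 1\le i\le m,\ 1\le j\le d,\ 1\le s_j\le r_j .$$ *)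

theory Defs
  imports "HOL-Computational_Algebra.Polynomial" "Jordan_Normal_Form.Determinant"
begin

text \<open>
  K is a type of class \<open>field_char_0\<close>; the rational parameters \<open>x\<close> enter K through \<open>of_rat\<close>.
  K[z][t] is \<open>'a poly poly\<close>: the outer variable is t, the coefficients are polynomials in z.
  The families \<open>\<alpha>\<close>, \<open>x\<close> and \<open>r\<close> are indexed from 1.
\<close>

definition S_op :: "nat \<Rightarrow> rat \<Rightarrow> 'a::field_char_0 poly \<Rightarrow> 'a poly" where
  "S_op n x p =
     (\<Sum>k\<le>degree p. monom (coeff p k * (pochhammer (of_nat k + of_rat x + 1) n / fact n)) k)"

definition phi :: "'a::field_char_0 \<Rightarrow> rat \<Rightarrow> nat \<Rightarrow> 'a poly \<Rightarrow> 'a" where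
  "phi \<alpha> x s p =
     (\<Sum>k\<le>degree p. coeff p k * (\<alpha> ^ (k + 1) / (of_nat k + of_rat x + 1) ^ s))"

text \<open>The K[z]-linear extension of \<open>phi\<close> to K[z][t].\<close>

definition phi_ext :: "'a::field_char_0 \<Rightarrow> rat \<Rightarrow> nat \<Rightarrow> 'a poly poly \<Rightarrow> 'a poly" where
  "phi_ext \<alpha> x s Q = (\<Sum>k\<le>degree Q. smult (phi \<alpha> x s (monom 1 k)) (coeff Q k))"

text \<open>\<open>(P(z) - P(t)) / (z - t)\<close> in K[z][t]; the division is exact by \<open>diff_quot_mult\<close> below.\<close>

definition diff_quot :: "'a::field_char_0 poly \<Rightarrow> 'a poly poly" where
  "diff_quot P = ([:P:] - map_poly (\<lambda>c. [:c:]) P) div [: [:0, 1:], - 1 :]"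

definition rho :: "nat \<Rightarrow> (nat \<Rightarrow> nat) \<Rightarrow> nat" where
  "rho d r = (\<Sum>j=1..d. r j)"

definition A_poly :: "nat \<Rightarrow> nat \<Rightarrow> (nat \<Rightarrow> nat) \<Rightarrow> nat \<Rightarrow> (nat \<Rightarrow> 'a::field_char_0) \<Rightarrow> nat \<Rightarrow> 'a poly" where
  "A_poly m d r n \<alpha> l = monom 1 l * (\<Prod>i=1..m. [:- \<alpha> i, 1:] ^ (rho d r * n))"

definition P_poly ::
  "nat \<Rightarrow> nat \<Rightarrow> (nat \<Rightarrow> nat) \<Rightarrow> nat \<Rightarrow> (nat \<Rightarrow> 'a::field_char_0) \<Rightarrow> (nat \<Rightarrow> rat) \<Rightarrow> nat \<Rightarrow> 'a poly" where
  "P_poly m d r n \<alpha> x l = foldr (\<lambda>j. S_op n (x j) ^^ r j) [1..<Suc d] (A_poly m d r n \<alpha> l)"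

definition P_aux ::
  "nat \<Rightarrow> nat \<Rightarrow> (nat \<Rightarrow> nat) \<Rightarrow> nat \<Rightarrow> (nat \<Rightarrow> 'a::field_char_0) \<Rightarrow> (nat \<Rightarrow> rat) \<Rightarrow> nat \<Rightarrow>
   nat \<times> nat \<times> nat \<Rightarrow> 'a poly" where
  "P_aux m d r n \<alpha> x l = (\<lambda>(i, j, s). phi_ext (\<alpha> i) (x j) s (diff_quot (P_poly m d r n \<alpha> x l)))"

definition idx_set :: "nat \<Rightarrow> nat \<Rightarrow> (nat \<Rightarrow> nat) \<Rightarrow> (nat \<times> nat \<times> nat) set" where
  "idx_set m d r = {(i, j, s). i \<in> {1..m} \<and> j \<in> {1..d} \<and> s \<in> {1..r j}}"

text \<open>
  The column vector \<open>p\<^sub>l(z)\<close>. Vectors are indexed from 0; entry 0 is \<open>P\<^sub>l\<close>, and the entries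
  1, ..., \<open>rho d r * m\<close> are listed in the order given by an enumeration \<open>e\<close> of \<open>idx_set m d r\<close>.
\<close>

definition p_vec ::
  "nat \<Rightarrow> nat \<Rightarrow> (nat \<Rightarrow> nat) \<Rightarrow> nat \<Rightarrow> (nat \<Rightarrow> 'a::field_char_0) \<Rightarrow> (nat \<Rightarrow> rat) \<Rightarrow>
   (nat \<Rightarrow> nat \<times> nat \<times> nat) \<Rightarrow> nat \<Rightarrow> 'a poly vec" where
  "p_vec m d r n \<alpha> x e l =
     vec (rho d r * m + 1)
       (\<lambda>k. if k = 0 then P_poly m d r n \<alpha> x l else P_aux m d r n \<alpha> x l (e k))"

definition Delta ::
  "nat \<Rightarrow> nat \<Rightarrow> (nat \<Rightarrow> nat) \<Rightarrow> nat \<Rightarrow> (nat \<Rightarrow> 'a::field_char_0) \<Rightarrow> (nat \<Rightarrow> rat) \<Rightarrow>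
   (nat \<Rightarrow> nat \<times> nat \<times> nat) \<Rightarrow> 'a poly" where
  "Delta m d r n \<alpha> x e =
     det (mat_of_cols (rho d r * m + 1) (map (p_vec m d r n \<alpha> x e) [0..<rho d r * m + 1]))"

lemma S_op_monom:
  "S_op n x (monom 1 k) = smult (pochhammer (of_nat k + of_rat x + 1) n / fact n) (monom 1 k)"
proof -
  have "S_op n x (monom 1 k) =
    (\<Sum>i\<le>k. if i = k then monom (pochhammer (of_nat k + of_rat x + 1) n / fact n) k else 0)"
    unfolding S_op_def by (rule sum.cong) (auto simp: degree_monom_eq)
  then show ?thesis by (simp add: smult_monom)
qed

lemma phi_monom:
  "phi \<alpha> x s (monom 1 k) = \<alpha> ^ (k + 1) / (of_nat k + of_rat x + 1) ^ s"
proof -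
  have "phi \<alpha> x s (monom 1 k) =
    (\<Sum>i\<le>k. if i = k then \<alpha> ^ (k + 1) / (of_nat k + of_rat x + 1) ^ s else 0)"
    unfolding phi_def by (rule sum.cong) (auto simp: degree_monom_eq)
  then show ?thesis by simp
qed

lemma diff_quot_mult:
  "diff_quot P * [: [:0, 1:], - 1 :] = [:P:] - map_poly (\<lambda>c. [:c:]) P"
proof -
  have "poly (map_poly (\<lambda>c. [:c:]) P) [:0, 1:] = P"
    by (induction P) (auto simp: map_poly_pCons)
  then have "[:- [:0, 1:], 1:] dvd [:P:] - map_poly (\<lambda>c. [:c:]) P"
    by (subst poly_eq_0_iff_dvd[symmetric]) simp
  moreover have "[: [:0, 1:], - 1 :] = - [:- [:0, 1:], 1 :: 'a poly:]"
    by simp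
  ultimately have "[: [:0, 1:], - 1 :] dvd [:P:] - map_poly (\<lambda>c. [:c:]) P"
    by (metis minus_dvd_iff)
  then show ?thesis
    unfolding diff_quot_def by (rule dvd_div_mult_self)
qed

end

theory Submission
  imports Defs
begin

text \<open>
  Write \<open>\<rho>\<close> for \<open>rho d r\<close>, \<open>b = \<rho> m (n + 1)\<close>, and let \<open>G(u)\<close> be the scalar by which the composed
  operators \<open>S\<close> multiply \<open>t\<^sup>u\<close>. As a function of \<open>u\<close> it is a polynomial of degree \<open>\<rho> n\<close> without zeros
  at the natural numbers.

  Why the determinant is constant. For an index \<open>(i, j, s)\<close> let \<open>f\<close> be the Laurent series
  \<open>\<phi>(1 / (z - t))\<close> in \<open>1/z\<close>. Then \<open>f P\<^sub>l - P\<^sub>l\<^sub>,\<^sub>i\<^sub>,\<^sub>j\<^sub>,\<^sub>s\<close> is the series with coefficient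
  \<open>\<phi>(t\<^sup>k P\<^sub>l)\<close> at \<open>1/z\<^sup>k\<^sup>+\<^sup>1\<close>. For \<open>k < n\<close> the denominator \<open>(u + k + x\<^sub>j + 1)\<^sup>s\<close> cancels against \<open>G(u)\<close>, so
  that \<open>\<phi>(t\<^sup>k P\<^sub>l)\<close> is \<open>\<Sum>\<^sub>u a\<^sub>u \<alpha>\<^sup>u q(u)\<close>, up to a power of \<open>\<alpha>\<close>, with \<open>a\<^sub>u\<close> the coefficients of \<open>A\<^sub>l\<close> and \<open>q\<close> a polynomial
  of degree less than \<open>\<rho> n\<close>; this vanishes because \<open>\<alpha>\<close> is a zero of \<open>A\<^sub>l\<close> of order \<open>\<rho> n\<close>
  (\<open>early_moments_vanish\<close>). To stay within polynomials, \<open>f\<close> is truncated and everything is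
  multiplied by \<open>z\<^sup>N\<close>, where \<open>N = b + n + 1\<close>. The row operations
  that replace each row \<open>P\<^sub>l\<^sub>,\<^sub>i\<^sub>,\<^sub>j\<^sub>,\<^sub>s\<close> by its remainder multiply the determinant by \<open>\<plusminus> z\<close> to the power
  \<open>N \<rho> m = b (\<rho> m + 1)\<close>, and afterwards all entries have degree at most \<open>b\<close>. Comparing
  degrees, \<open>\<Delta>\<close> is a constant, equal up to sign to the determinant of the matrix of the coefficients
  at \<open>z\<^sup>b\<close>.

  Why it is nonzero. A vector in the kernel of that matrix gives a combination \<open>A\<close> of the \<open>A\<^sub>l\<close>
  of degree less than \<open>b\<close> with \<open>\<Sum>\<^sub>u a\<^sub>u \<alpha>\<^sub>i\<^sup>u G(u) / (u + n + x\<^sub>j + 1)\<^sup>s = 0\<close> for all \<open>i, j, s\<close>.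
  Put \<open>D(u) = \<Prod>\<^sub>j (u + n + x\<^sub>j + 1)\<close>, the \<open>j\<close>-th factor raised to the power \<open>r\<^sub>j\<close>, and divide the coefficients of \<open>A\<close>
  by \<open>D(u)\<close> to get a polynomial \<open>B\<close>. The
  functional \<open>q \<mapsto> \<Sum>\<^sub>u b\<^sub>u \<alpha>\<^sub>i\<^sup>u q(u)\<close> then kills \<open>D h\<close> for \<open>deg h < \<rho> n\<close>, by the order of vanishing of
  \<open>A\<close>, and all \<open>G D / (u + n + x\<^sub>j + 1)\<^sup>s\<close>. As \<open>G\<close> and \<open>D\<close> have no common zero (the \<open>x\<^sub>j\<close> are
  incongruent modulo the integers), a Bezout decomposition together with partial fractions shows that
  it kills every \<open>q\<close> of degree less than \<open>\<rho> (n + 1)\<close>. Hence \<open>B\<close> vanishes to order \<open>\<rho> (n + 1)\<close> at each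
  of the \<open>m\<close> points \<open>\<alpha>\<^sub>i\<close>, while its degree is less than \<open>b\<close>; so \<open>B\<close>, and with it \<open>A\<close>, is zero
  (\<open>interpolation_unique\<close>).
\<close>

section \<open>Coefficientwise multiplication and order of vanishing\<close>

definition hadamard :: "(nat \<Rightarrow> 'a::comm_ring_1) \<Rightarrow> 'a poly \<Rightarrow> 'a poly" where
  "hadamard w p = (\<Sum>k\<le>degree p. monom (w k * coeff p k) k)"

lemma coeff_hadamard [simp]: "coeff (hadamard w p) k = w k * coeff p k"
proof -
  have "coeff (hadamard w p) k = (\<Sum>i\<le>degree p. if i = k then w k * coeff p k else 0)"
    unfolding hadamard_def coeff_sum by (rule sum.cong) auto
  then show ?thesis by (simp add: coeff_eq_0)
qed

lemma hadamard_hadamard: "hadamard v (hadamard w p) = hadamard (\<lambda>k. v k * w k) p"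
  by (rule poly_eqI) (simp add: mult.assoc)

lemma hadamard_smult_sum:
  "hadamard w (\<Sum>l\<in>L. smult (b l) (f l)) = (\<Sum>l\<in>L. smult (b l) (hadamard w (f l)))"
  by (rule poly_eqI) (simp add: coeff_sum sum_distrib_left mult.left_commute)

lemma degree_hadamard_le: "degree (hadamard w p) \<le> degree p"
  by (rule degree_le) (simp add: coeff_eq_0)

lemma poly_hadamard_eq_sum:
  assumes "degree p < N"
  shows "poly (hadamard w p) a = (\<Sum>u<N. w u * coeff p u * a ^ u)"
proof -
  have "poly (hadamard w p) a = (\<Sum>u\<le>degree (hadamard w p). w u * coeff p u * a ^ u)"
    by (simp add: poly_altdef)
  also have "\<dots> = (\<Sum>u<N. w u * coeff p u * a ^ u)"
  proof (rule sum.mono_neutral_left)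
    show "{..degree (hadamard w p)} \<subseteq> {..<N}"
      using degree_hadamard_le[of w p] assms by auto
    show "\<forall>u\<in>{..<N} - {..degree (hadamard w p)}. w u * coeff p u * a ^ u = 0"
      by (simp add: coeff_eq_0 flip: coeff_hadamard)
  qed simp
  finally show ?thesis .
qed

lemma hadamard_of_nat: "hadamard of_nat p = pCons 0 (pderiv p)"
  by (rule poly_eqI) (simp add: coeff_pCons coeff_pderiv split: nat.split)

text \<open>
  \<open>hadamard of_nat\<close> is the Euler derivation \<open>t d/dt\<close>. Away from the origin, in characteristic 0, it
  lowers the order of a zero by exactly one, just as the derivative does.
\<close>

lemma linear_power_Suc_dvd_iff:
  fixes a :: "'a::field_char_0"
  assumes "a \<noteq> 0"
  shows "[:- a, 1:] ^ Suc M dvd p \<longleftrightarrow> poly p a = 0 \<and> [:- a, 1:] ^ M dvd hadamard of_nat p"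
proof (cases "poly p a = 0 \<and> p \<noteq> 0")
  case False
  have "poly p a = 0" if "[:- a, 1:] ^ Suc M dvd p"
    using that by (metis dvd_mult_left poly_eq_0_iff_dvd power_Suc)
  then show ?thesis using False by (auto simp: hadamard_def)
next
  case True
  have pd: "pderiv p \<noteq> 0"
  proof
    assume "pderiv p = 0"
    then obtain c where "p = [:c:]" by (metis pderiv_iszero)
    with True show False by simp
  qed
  have X: "pCons 0 (pderiv p) = [:0, 1:] * pderiv p" by simp
  have "order a p = Suc (order a (pderiv p))"
    using True pd by (intro order_pderiv) (auto simp: order_root)
  moreover have "order a (pCons 0 (pderiv p)) = order a (pderiv p)"
    unfolding X using pd assms by (subst order_mult) (auto simp: order_0I)
  ultimately show ?thesis
    using True pd by (simp only: hadamard_of_nat order_divides) auto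
qed

text \<open>
  Multiplying \<open>q\<close> by the variable \<open>u\<close> amounts to applying the Euler derivation to \<open>p\<close>, so the
  moments of \<open>p\<close> against all \<open>q\<close> of degree less than \<open>M\<close> encode the values at \<open>a\<close> of \<open>p\<close> and its first
  \<open>M - 1\<close> Euler derivatives. This equivalence is used in both directions: to read off vanishing moments from
  the factors of \<open>A\<^sub>l\<close>, and to recover factors from vanishing moments.
\<close>

lemma linear_power_dvd_iff_moments:
  fixes a :: "'a::field_char_0"
  assumes "a \<noteq> 0"
  shows "[:- a, 1:] ^ M dvd p \<longleftrightarrow>
    (\<forall>q. degree q < M \<longrightarrow> poly (hadamard (\<lambda>u. poly q (of_nat u)) p) a = 0)"
proof (induction M arbitrary: p)
  case 0
  then show ?case by simp
next
  case (Suc M)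
  have step: "poly (hadamard (\<lambda>u. poly (pCons c q) (of_nat u)) p) a =
    c * poly p a + poly (hadamard (\<lambda>u. poly q (of_nat u)) (hadamard of_nat p)) a" for c q
  proof -
    have "hadamard (\<lambda>u. poly (pCons c q) (of_nat u)) p =
      smult c p + hadamard (\<lambda>u. poly q (of_nat u)) (hadamard of_nat p)"
      by (rule poly_eqI) (simp add: algebra_simps)
    then show ?thesis by simp
  qed
  show ?case
  proof
    assume "[:- a, 1:] ^ Suc M dvd p"
    then have root: "poly p a = 0" and dvd: "[:- a, 1:] ^ M dvd hadamard of_nat p"
      using linear_power_Suc_dvd_iff[OF assms] by blast+
    show "\<forall>q. degree q < Suc M \<longrightarrow> poly (hadamard (\<lambda>u. poly q (of_nat u)) p) a = 0"
    proof (intro allI impI)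
      fix q :: "'a poly"
      assume deg: "degree q < Suc M"
      obtain c q' where q: "q = pCons c q'" by (cases q)
      have "poly (hadamard (\<lambda>u. poly q' (of_nat u)) (hadamard of_nat p)) a = 0"
      proof (cases "q' = 0")
        case True
        then show ?thesis by (simp add: hadamard_def)
      next
        case False
        then have "degree q' < M" using deg q by simp
        then show ?thesis using Suc.IH dvd by blast
      qed
      then show "poly (hadamard (\<lambda>u. poly q (of_nat u)) p) a = 0"
        unfolding q step by (simp add: root)
    qed
  next
    assume mom: "\<forall>q. degree q < Suc M \<longrightarrow> poly (hadamard (\<lambda>u. poly q (of_nat u)) p) a = 0"
    have root: "poly p a = 0"
      using mom[rule_format, of "[:1:]"] step[of 1 0] by (simp add: hadamard_def)
    have "poly (hadamard (\<lambda>u. poly q (of_nat u)) (hadamard of_nat p)) a = 0"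
      if "degree q < M" for q
      using mom[rule_format, of "pCons 0 q"] that unfolding step by (simp add: root)
    then show "[:- a, 1:] ^ Suc M dvd p"
      using Suc.IH root linear_power_Suc_dvd_iff[OF assms] by blast
  qed
qed

section \<open>Comaximal polynomials and partial fractions\<close>

text \<open>
  The Bezout form of coprimality: it passes to products in either argument by pure algebra, and
  it directly provides the cofactors needed below.
\<close>

definition comaximal :: "'a::comm_ring_1 \<Rightarrow> 'a \<Rightarrow> bool" where
  "comaximal p q \<longleftrightarrow> (\<exists>u v. u * p + v * q = 1)"

lemma comaximal_commute: "comaximal p q \<longleftrightarrow> comaximal q p"
  unfolding comaximal_def by (metis add.commute)

lemma comaximal_1_left [simp]: "comaximal 1 q"
  unfolding comaximal_def by (rule exI[of _ 1], rule exI[of _ 0]) simp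

lemma comaximal_mult_left:
  assumes "comaximal p r" and "comaximal q r"
  shows "comaximal (p * q) r"
proof -
  obtain u v u' v' where 1: "u * p + v * r = 1" and 2: "u' * q + v' * r = 1"
    using assms unfolding comaximal_def by blast
  have "(u * p + v * r) * (u' * q + v' * r) =
    (u * u') * (p * q) + (u * p * v' + v * u' * q + v * r * v') * r"
    by (simp add: algebra_simps)
  then show ?thesis unfolding comaximal_def 1 2 by (metis mult_1)
qed

lemma comaximal_power_left: "comaximal p r \<Longrightarrow> comaximal (p ^ k) r"
  by (induction k) (auto intro: comaximal_mult_left)

lemma comaximal_prod_left: "(\<And>i. i \<in> I \<Longrightarrow> comaximal (f i) r) \<Longrightarrow> comaximal (prod f I) r"
  by (induction I rule: infinite_finite_induct) (auto intro: comaximal_mult_left)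

lemma comaximal_linear:
  fixes c c' :: "'a::field"
  assumes "c \<noteq> c'"
  shows "comaximal [:c, 1:] [:c', 1:]"
proof -
  have "[:1 / (c - c'):] * [:c, 1:] + [:- 1 / (c - c'):] * [:c', 1:] = [:(c - c') / (c - c'):]"
    by simp (simp flip: diff_divide_distrib)
  also have "\<dots> = 1" using assms by simp
  finally have "[:1 / (c - c'):] * [:c, 1:] + [:- 1 / (c - c'):] * [:c', 1:] = 1" .
  then show ?thesis unfolding comaximal_def by blast
qed

lemma comaximal_mult_dvd:
  assumes "comaximal p q" and "p dvd f" and "q dvd f"
  shows "p * q dvd f"
proof -
  obtain u v where 1: "u * p + v * q = 1" using assms(1) unfolding comaximal_def by blast
  obtain g where g: "f = p * g" using assms(2) by (rule dvdE)
  obtain h where h: "f = q * h" using assms(3) by (rule dvdE)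
  have "f = (u * p + v * q) * f" by (simp add: 1)
  also have "\<dots> = u * p * f + v * q * f" by (simp add: algebra_simps)
  also have "\<dots> = u * p * (q * h) + v * q * (p * g)" using g h by metis
  also have "\<dots> = p * q * (u * h + v * g)" by (simp add: algebra_simps)
  finally show ?thesis by (metis dvd_triv_left)
qed

lemma prod_linear_powers_dvd:
  fixes c :: "'i \<Rightarrow> 'a::field"
  assumes "finite I" and "inj_on c I" and "\<And>i. i \<in> I \<Longrightarrow> [:c i, 1:] ^ k dvd f"
  shows "(\<Prod>i\<in>I. [:c i, 1:] ^ k) dvd f"
  using assms
proof (induction I rule: finite_induct)
  case empty
  then show ?case by simp
next
  case (insert j I)
  have "comaximal [:c j, 1:] [:c i, 1:]" if "i \<in> I" for i
    using insert that by (intro comaximal_linear) (auto simp: inj_on_def)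
  then have "comaximal ([:c j, 1:] ^ k) (\<Prod>i\<in>I. [:c i, 1:] ^ k)"
    by (intro comaximal_power_left, subst comaximal_commute)
       (rule comaximal_prod_left, rule comaximal_power_left, subst comaximal_commute, blast)
  then show ?case using insert by (auto intro!: comaximal_mult_dvd)
qed

text \<open>
  Multiply a Bezout identity by \<open>f\<close> and reduce the first cofactor modulo \<open>q\<close>; the degree of the
  second is then forced.
\<close>

lemma comaximal_decomposition:
  fixes p q f :: "'a::field poly"
  assumes co: "comaximal p q" and "p \<noteq> 0" and "q \<noteq> 0"
    and f: "f = 0 \<or> degree f < degree p + degree q"
  obtains g h where "f = g * p + h * q"
    and "g = 0 \<or> degree g < degree q" and "h = 0 \<or> degree h < degree p"
proof -
  obtain u v where 1: "u * p + v * q = 1" using co unfolding comaximal_def by blast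
  define g where "g = (f * u) mod q"
  define h where "h = f * v + ((f * u) div q) * p"
  have "f = f * (u * p + v * q)" by (simp add: 1)
  also have "\<dots> = (f * u) * p + f * v * q" by (simp add: algebra_simps)
  also have "f * u = (f * u) div q * q + g" by (simp add: g_def)
  finally have eq: "f = g * p + h * q" by (simp add: h_def algebra_simps)
  have g: "g = 0 \<or> degree g < degree q"
    unfolding g_def using \<open>q \<noteq> 0\<close> by (rule degree_mod_less)
  have h: "h = 0 \<or> degree h < degree p"
  proof (cases "h = 0")
    case False
    then have "h \<noteq> 0" by simp
    have hq: "h * q = f - g * p" using eq by simp
    have ne: "f - g * p \<noteq> 0" using hq \<open>h \<noteq> 0\<close> \<open>q \<noteq> 0\<close> by (metis mult_eq_0_iff)
    have gp: "g * p = 0 \<or> degree (g * p) < degree p + degree q"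
      using g \<open>p \<noteq> 0\<close> by (cases "g = 0") (auto simp: degree_mult_eq)
    have "degree (f - g * p) < degree p + degree q"
      using f gp ne by (auto intro: degree_diff_less)
    then show ?thesis
      using \<open>h \<noteq> 0\<close> \<open>q \<noteq> 0\<close> by (simp add: degree_mult_eq flip: hq)
  qed simp
  show thesis using that eq g h by blast
qed

text \<open>
  The spanning statements below are phrased as membership in an arbitrary subspace, since they are
  applied to the kernel of a linear functional.
\<close>

definition poly_subspace :: "'a::comm_ring_1 poly set \<Rightarrow> bool" where
  "poly_subspace W \<longleftrightarrow>
     0 \<in> W \<and> (\<forall>p\<in>W. \<forall>q\<in>W. p + q \<in> W) \<and> (\<forall>c. \<forall>p\<in>W. smult c p \<in> W)"

lemma poly_subspace_quotient: "poly_subspace W \<Longrightarrow> poly_subspace {f. g * f \<in> W}"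
  unfolding poly_subspace_def by (auto simp: distrib_left)

lemma mem_subspace_of_linear_powers:
  fixes c :: "'a::field"
  assumes "poly_subspace W" and "\<And>k. k < r \<Longrightarrow> [:c, 1:] ^ k \<in> W"
    and "f = 0 \<or> degree f < r"
  shows "f \<in> W"
  using assms
proof (induction r arbitrary: W f)
  case 0
  then show ?case by (auto simp: poly_subspace_def)
next
  case (Suc r)
  define g where "g = synthetic_div f (- c)"
  have f: "f = smult (poly f (- c)) 1 + [:c, 1:] * g"
    using synthetic_div_correct'[of "- c" f] by (simp add: g_def algebra_simps)
  have "g = 0 \<or> degree g < r"
    using Suc.prems(3) by (auto simp: g_def degree_synthetic_div synthetic_div_eq_0_iff)
  moreover have "[:c, 1:] ^ k \<in> {f. [:c, 1:] * f \<in> W}" if "k < r" for k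
    using Suc.prems(2)[of "Suc k"] that by simp
  ultimately have "[:c, 1:] * g \<in> W"
    using Suc.IH[OF poly_subspace_quotient[OF Suc.prems(1)]] by blast
  moreover have "smult (poly f (- c)) ([:c, 1:] ^ 0) \<in> W"
    using Suc.prems(1) Suc.prems(2)[of 0] unfolding poly_subspace_def by blast
  ultimately have "smult (poly f (- c)) ([:c, 1:] ^ 0) + [:c, 1:] * g \<in> W"
    using Suc.prems(1) unfolding poly_subspace_def by blast
  then show ?case using f by simp
qed

text \<open>
  With \<open>D = \<Prod>\<^sub>j (t + c\<^sub>j)\<close>, the \<open>j\<close>-th factor raised to the power \<open>r\<^sub>j\<close>, the generators are the polynomials
  \<open>D / (t + c\<^sub>j)\<^sup>s\<close> for \<open>s = r\<^sub>j - k\<close>.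
  So this is the partial fraction decomposition of \<open>f / D\<close>, multiplied by \<open>D\<close>. One pole is
  split off at a time.
\<close>

lemma mem_subspace_of_partial_fractions:
  fixes c :: "'i \<Rightarrow> 'a::field"
  assumes "finite J" and "inj_on c J" and "poly_subspace W"
    and "\<And>j k. j \<in> J \<Longrightarrow> k < r j \<Longrightarrow>
           [:c j, 1:] ^ k * (\<Prod>i\<in>J - {j}. [:c i, 1:] ^ r i) \<in> W"
    and "f = 0 \<or> degree f < sum r J"
  shows "f \<in> W"
  using assms
proof (induction J arbitrary: W f rule: finite_induct)
  case empty
  then show ?case by (auto simp: poly_subspace_def)
next
  case (insert j J)
  note gen = insert.prems(3)
  define p where "p = [:c j, 1:] ^ r j"
  define q where "q = (\<Prod>i\<in>J. [:c i, 1:] ^ r i)"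
  have "comaximal [:c j, 1:] [:c i, 1:]" if "i \<in> J" for i
    using insert that by (intro comaximal_linear) (auto simp: inj_on_def)
  then have co: "comaximal q p" unfolding p_def q_def
    by (intro comaximal_prod_left comaximal_power_left, subst comaximal_commute)
       (auto intro!: comaximal_power_left)
  have nz: "p \<noteq> 0" "q \<noteq> 0" unfolding p_def q_def using insert.hyps by auto
  have deg: "degree p = r j" "degree q = sum r J"
    unfolding p_def q_def by (auto simp: degree_linear_power degree_prod_sum_eq)
  have "f = 0 \<or> degree f < degree q + degree p"
    using insert deg by auto
  then obtain g h where f: "f = g * q + h * p"
    and g: "g = 0 \<or> degree g < r j" and h: "h = 0 \<or> degree h < sum r J"
    using comaximal_decomposition[OF co nz(2) nz(1)] deg by metis
  have "q * [:c j, 1:] ^ k \<in> W" if "k < r j" for k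
    using gen[of j k] that insert.hyps by (simp add: q_def mult.commute)
  then have 1: "q * g \<in> W"
    using mem_subspace_of_linear_powers[OF poly_subspace_quotient[OF insert.prems(2)] _ g] by blast
  have "p * ([:c i, 1:] ^ k * (\<Prod>i'\<in>J - {i}. [:c i', 1:] ^ r i')) \<in> W"
    if "i \<in> J" "k < r i" for i k
  proof -
    have "insert j J - {i} = insert j (J - {i})" using that insert.hyps by auto
    then show ?thesis
      using gen[of i k] that insert.hyps by (simp add: p_def mult.left_commute)
  qed
  then have 2: "p * h \<in> W"
    using insert.IH[OF _ poly_subspace_quotient[OF insert.prems(2)] _ h] insert.prems(1) by auto
  show ?case unfolding f
    using 1 2 insert.prems(2) by (auto simp: poly_subspace_def mult.commute)
qed

section \<open>Leading coefficients of determinants\<close>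

lemma coeff_mult_degree_bound:
  assumes "degree p \<le> a" and "degree q \<le> b"
  shows "coeff (p * q) (a + b) = coeff p a * coeff q b"
proof (cases "degree p = a \<and> degree q = b")
  case True
  then show ?thesis using coeff_mult_degree_sum by blast
next
  case False
  then have "degree (p * q) < a + b"
    using degree_mult_le[of p q] assms by linarith
  moreover have "coeff p a = 0 \<or> coeff q b = 0"
    using False assms by (metis coeff_eq_0 le_neq_implies_less)
  ultimately show ?thesis by (auto simp: coeff_eq_0)
qed

lemma degree_and_coeff_prod_bound:
  assumes "finite I" and "\<And>i. i \<in> I \<Longrightarrow> degree (f i) \<le> b"
  shows "degree (prod f I) \<le> b * card I \<and>
    coeff (prod f I) (b * card I) = (\<Prod>i\<in>I. coeff (f i) b)"
  using assms
proof (induction I rule: finite_induct)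
  case empty
  then show ?case by simp
next
  case (insert j I)
  have 1: "degree (f j) \<le> b" and 2: "degree (prod f I) \<le> b * card I"
    and 3: "coeff (prod f I) (b * card I) = (\<Prod>i\<in>I. coeff (f i) b)"
    using insert by auto
  have "coeff (f j * prod f I) (b + b * card I) = coeff (f j) b * coeff (prod f I) (b * card I)"
    using 1 2 by (rule coeff_mult_degree_bound)
  moreover have "degree (f j * prod f I) \<le> b + b * card I"
    using degree_mult_le[of "f j" "prod f I"] 1 2 by linarith
  ultimately show ?case using insert.hyps 3 by simp
qed

text \<open>
  In the Leibniz formula every product has \<open>N\<close> factors of degree at most \<open>b\<close>, so passing to the
  coefficient at \<open>b\<close> is compatible with it.
\<close>

lemma det_degree_and_coeff:
  fixes A :: "'a::comm_ring_1 poly mat"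
  assumes A: "A \<in> carrier_mat N N"
    and deg: "\<And>i j. i < N \<Longrightarrow> j < N \<Longrightarrow> degree (A $$ (i, j)) \<le> b"
  shows "degree (det A) \<le> b * N" and "coeff (det A) (b * N) = det (map_mat (\<lambda>p. coeff p b) A)"
proof -
  have perm: "p i < N" if "p permutes {0..<N}" "i < N" for p i
    using permutes_in_image[OF that(1), of i] that(2) by simp
  have bound: "degree (\<Prod>i=0..<N. A $$ (i, p i)) \<le> b * N \<and>
      coeff (\<Prod>i=0..<N. A $$ (i, p i)) (b * N) = (\<Prod>i=0..<N. coeff (A $$ (i, p i)) b)"
    if "p permutes {0..<N}" for p
    using degree_and_coeff_prod_bound[of "{0..<N}" "\<lambda>i. A $$ (i, p i)" b] deg perm[OF that] by simp
  have sgn: "(signof p :: 'a poly) * q = smult (signof p) q" for p q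
    by (simp add: sign_def)
  have D: "det A = (\<Sum>p | p permutes {0..<N}. smult (signof p) (\<Prod>i=0..<N. A $$ (i, p i)))"
    by (simp add: det_def'[OF A] sgn)
  show "degree (det A) \<le> b * N" unfolding D
    using bound by (intro degree_sum_le) (auto intro: order.trans[OF degree_smult_le] simp: finite_permutations)
  have "coeff (det A) (b * N) =
      (\<Sum>p | p permutes {0..<N}. signof p * (\<Prod>i=0..<N. coeff (A $$ (i, p i)) b))"
    unfolding D coeff_sum using bound by (intro sum.cong) auto
  also have "\<dots> = det (map_mat (\<lambda>p. coeff p b) A)"
    using A perm by (subst det_def'[of _ N]) (auto intro!: sum.cong prod.cong)
  finally show "coeff (det A) (b * N) = det (map_mat (\<lambda>p. coeff p b) A)" .
qed


section \<open>The remainders of the approximation problem\<close>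

text \<open>
  The quotient \<open>(z\<^sup>u - t\<^sup>u) / (z - t)\<close> is \<open>\<Sum>\<^sub>a t\<^sup>a z\<^sup>u\<^sup>-\<^sup>1\<^sup>-\<^sup>a\<close>; hence the coefficient at \<open>t\<^sup>b\<close> of
  the difference quotient drops the lowest \<open>b + 1\<close> coefficients of \<open>P\<close>. The proof compares
  coefficients of \<open>t\<^sup>b\<close> after multiplying by \<open>z - t\<close>.
\<close>

lemma coeff_diff_quot: "coeff (diff_quot P) b = poly_shift (Suc b) P"
proof -
  have shift: "pCons 0 (poly_shift (Suc b) P) = poly_shift b P - [:coeff P b:]" for b
    by (rule poly_eqI) (simp add: coeff_poly_shift coeff_pCons split: nat.split)
  have rel: "pCons 0 (coeff (diff_quot P) b) - (case b of 0 \<Rightarrow> 0 | Suc c \<Rightarrow> coeff (diff_quot P) c) =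
      (if b = 0 then P else 0) - [:coeff P b:]" for b
    using arg_cong[OF diff_quot_mult[of P], of "\<lambda>Q. coeff Q b"]
    by (simp add: coeff_pCons coeff_map_poly split: nat.splits)
  show ?thesis
  proof (induction b)
    case 0
    have "pCons 0 (coeff (diff_quot P) 0) = pCons 0 (poly_shift (Suc 0) P)"
      using rel[of 0] shift[of 0] by simp
    then show ?case by simp
  next
    case (Suc b)
    have "pCons 0 (coeff (diff_quot P) (Suc b)) - poly_shift (Suc b) P = 0 - [:coeff P (Suc b):]"
      using rel[of "Suc b"] by (simp add: Suc)
    then have "pCons 0 (coeff (diff_quot P) (Suc b)) = poly_shift (Suc b) P - [:coeff P (Suc b):]"
      unfolding diff_eq_eq by simp
    also have "\<dots> = pCons 0 (poly_shift (Suc (Suc b)) P)"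
      by (rule shift[symmetric])
    finally show ?case by simp
  qed
qed

lemma phi_ext_diff_quot:
  assumes "degree P \<le> M"
  shows "phi_ext \<alpha> x s (diff_quot P) =
    (\<Sum>b\<le>M. smult (phi \<alpha> x s (monom 1 b)) (poly_shift (Suc b) P))"
proof -
  have "poly_shift (Suc b) P = 0" if "b > degree P" for b
    using that by (intro poly_eqI) (simp add: coeff_poly_shift coeff_eq_0)
  then have "degree (diff_quot P) \<le> M"
    using assms by (intro degree_le) (simp add: coeff_diff_quot)
  then show ?thesis
    unfolding phi_ext_def
    by (intro sum.mono_neutral_cong_left) (auto simp: coeff_eq_0 simp flip: coeff_diff_quot)
qed

text \<open>
  This is \<open>z\<^sup>M\<^sup>+\<^sup>1 (f P - \<phi>((P(z) - P(t)) / (z - t)))\<close> with the series \<open>f = \<Sum>\<^sub>b \<phi>(t\<^sup>b) / z\<^sup>b\<^sup>+\<^sup>1\<close> truncated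
  after \<open>b = M\<close>. The truncation leaves the coefficients at \<open>z\<^sup>M\<^sup>-\<^sup>k\<close> unchanged as long as
  \<open>deg P + k \<le> M\<close>.
\<close>

definition remainder :: "'a::field_char_0 \<Rightarrow> rat \<Rightarrow> nat \<Rightarrow> nat \<Rightarrow> 'a poly \<Rightarrow> 'a poly" where
  "remainder \<alpha> x s M P =
     (\<Sum>b\<le>M. monom (phi \<alpha> x s (monom 1 b)) (M - b)) * P -
     monom 1 (Suc M) * phi_ext \<alpha> x s (diff_quot P)"

lemma remainder_eq_cutoffs:
  assumes "degree P \<le> M"
  shows "remainder \<alpha> x s M P =
    (\<Sum>b\<le>M. monom (phi \<alpha> x s (monom 1 b)) (M - b) * poly_cutoff (Suc b) P)"
proof -
  have tail: "monom 1 k * poly_shift k P = P - poly_cutoff k P" for k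
    by (rule poly_eqI) (simp add: coeff_poly_cutoff coeff_poly_shift coeff_monom_mult)
  have "monom 1 (Suc M) * smult c (poly_shift (Suc b) P) =
      monom c (M - b) * P - monom c (M - b) * poly_cutoff (Suc b) P" if "b \<le> M" for b c
  proof -
    have "monom 1 (Suc M) * smult c (poly_shift (Suc b) P) =
        monom c (Suc M) * poly_shift (Suc b) P"
      by (simp add: smult_monom flip: mult_smult_left)
    also have "monom c (Suc M) = monom c (M - b) * monom 1 (Suc b)"
      using that by (simp add: mult_monom)
    also have "\<dots> * poly_shift (Suc b) P = monom c (M - b) * (P - poly_cutoff (Suc b) P)"
      by (simp only: mult.assoc tail)
    finally show ?thesis by (simp only: right_diff_distrib)
  qed
  then show ?thesis
    unfolding remainder_def phi_ext_diff_quot[OF assms] sum_distrib_left sum_distrib_right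
    by (simp flip: sum_subtractf)
qed

lemma degree_remainder_le:
  assumes "degree P \<le> M"
  shows "degree (remainder \<alpha> x s M P) \<le> M"
proof -
  have cutoff: "degree (poly_cutoff (Suc b) P) \<le> b" for b
    by (rule degree_le) (simp add: coeff_poly_cutoff)
  have "degree (monom c (M - b) * poly_cutoff (Suc b) P) \<le> M" if "b \<le> M" for b c
    using that degree_mult_le[of "monom c (M - b)" "poly_cutoff (Suc b) P"]
      degree_monom_le[of c "M - b"] cutoff[of b]
    by linarith
  then show ?thesis
    unfolding remainder_eq_cutoffs[OF assms] by (intro degree_sum_le) auto
qed

text \<open>
  The right-hand side is \<open>\<phi>(t\<^sup>k P)\<close>, written as the value at \<open>\<alpha>\<close> of a coefficientwise product.
\<close>

lemma coeff_remainder: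
  assumes "degree P + k \<le> M"
  shows "coeff (remainder \<alpha> x s M P) (M - k) =
    \<alpha> ^ (k + 1) * poly (hadamard (\<lambda>u. 1 / (of_nat u + of_nat k + of_rat x + 1) ^ s) P) \<alpha>"
proof -
  have "coeff (remainder \<alpha> x s M P) (M - k) =
      (\<Sum>b\<le>M. if k \<le> b then phi \<alpha> x s (monom 1 b) * coeff P (b - k) else 0)"
    using assms by (subst remainder_eq_cutoffs)
      (auto simp: coeff_sum coeff_monom_mult coeff_poly_cutoff intro!: sum.cong)
  also have "\<dots> = (\<Sum>b\<in>{k..M}. phi \<alpha> x s (monom 1 b) * coeff P (b - k))"
    by (subst sum.inter_filter[symmetric]) (auto intro!: sum.cong)
  also have "\<dots> = (\<Sum>u<Suc (M - k). phi \<alpha> x s (monom 1 (u + k)) * coeff P u)"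
    using assms
    by (intro sum.reindex_bij_witness[of _ "\<lambda>u. u + k" "\<lambda>b. b - k"]) auto
  also have "\<dots> = \<alpha> ^ (k + 1) *
      (\<Sum>u<Suc (M - k). 1 / (of_nat u + of_nat k + of_rat x + 1) ^ s * coeff P u * \<alpha> ^ u)"
    unfolding sum_distrib_left
    by (intro sum.cong refl) (simp add: phi_monom power_add)
  also have "\<dots> = \<alpha> ^ (k + 1) *
      poly (hadamard (\<lambda>u. 1 / (of_nat u + of_nat k + of_rat x + 1) ^ s) P) \<alpha>"
    using assms by (subst poly_hadamard_eq_sum[of P "Suc (M - k)"]) auto
  finally show ?thesis .
qed

section \<open>The weight of the shift operators\<close>

definition pochhammer_poly :: "'a::field_char_0 \<Rightarrow> nat \<Rightarrow> 'a poly" where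
  "pochhammer_poly y n = smult (1 / fact n) (\<Prod>i<n. [:of_nat i + y + 1, 1:])"

lemma poly_pochhammer_poly:
  "poly (pochhammer_poly y n) u = pochhammer (u + y + 1) n / fact n"
  by (simp add: pochhammer_poly_def poly_prod pochhammer_prod lessThan_atLeast0 algebra_simps)

lemma degree_pochhammer_poly: "degree (pochhammer_poly y n) = n"
  by (simp add: pochhammer_poly_def degree_prod_sum_eq)

lemma S_op_eq_hadamard:
  "S_op n x = hadamard (\<lambda>u. poly (pochhammer_poly (of_rat x) n) (of_nat u))"
  by (rule ext) (simp add: S_op_def hadamard_def poly_pochhammer_poly mult.commute)

lemma hadamard_funpow: "hadamard w ^^ k = hadamard (\<lambda>u. w u ^ k)"
proof (induction k)
  case 0
  show ?case by (rule ext, rule poly_eqI) simp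
next
  case (Suc k)
  then show ?case by (auto simp: hadamard_hadamard)
qed

lemma foldr_hadamard:
  "foldr (\<lambda>j. hadamard (w j)) js p = hadamard (\<lambda>u. \<Prod>j\<leftarrow>js. w j u) p"
proof (induction js)
  case Nil
  show ?case by (rule poly_eqI) simp
next
  case (Cons j js)
  then show ?case by (simp add: hadamard_hadamard)
qed

text \<open>
  The eigenvalue of the composed operators \<open>S\<close> on \<open>t\<^sup>u\<close>, as a polynomial in \<open>u\<close>.
\<close>

definition weight_poly ::
  "nat \<Rightarrow> (nat \<Rightarrow> nat) \<Rightarrow> nat \<Rightarrow> (nat \<Rightarrow> rat) \<Rightarrow> 'a::field_char_0 poly" where
  "weight_poly d r n x = (\<Prod>j=1..d. pochhammer_poly (of_rat (x j)) n ^ r j)"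

lemma P_poly_eq_hadamard:
  "P_poly m d r n \<alpha> x l =
     hadamard (\<lambda>u. poly (weight_poly d r n x) (of_nat u)) (A_poly m d r n \<alpha> l)"
proof -
  have "(\<Prod>j\<leftarrow>[1..<Suc d]. f j) = (\<Prod>j=1..d. f j)" for f :: "nat \<Rightarrow> 'a"
    by (subst prod.distinct_set_conv_list[symmetric])
       (simp_all only: distinct_upt set_upt atLeastLessThanSuc_atLeastAtMost)
  then show ?thesis
    unfolding P_poly_def S_op_eq_hadamard hadamard_funpow foldr_hadamard weight_poly_def
    by (simp add: poly_prod del: upt_Suc)
qed

lemma degree_weight_poly: "degree (weight_poly d r n x) = rho d r * n"
proof -
  have nz: "pochhammer_poly y n \<noteq> 0" for y :: 'a
    by (auto simp: pochhammer_poly_def)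
  have "degree (pochhammer_poly y n ^ k) = k * n" for y :: 'a and k
    using nz by (simp add: degree_power_eq degree_pochhammer_poly)
  then show ?thesis
    using nz by (simp add: weight_poly_def degree_prod_sum_eq rho_def sum_distrib_right)
qed

lemma shifted_rat_nonzero:
  assumes "\<not> (y \<in> \<int> \<and> y < 0)"
  shows "of_nat u + of_rat y + 1 \<noteq> (0 :: 'a::field_char_0)"
proof
  assume "of_nat u + of_rat y + 1 = (0 :: 'a)"
  then have "of_rat (of_nat u + y + 1) = (of_rat 0 :: 'a)" by (simp add: of_rat_add)
  then have "of_nat u + y + 1 = 0" by (simp only: of_rat_eq_iff)
  then have y: "y = - of_nat (Suc u)" by simp
  then have "y \<in> \<int>" "y < 0" by (simp only: Ints_minus Ints_of_nat, simp)
  with assms show False by blast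
qed

lemma shifted_rats_distinct:
  assumes "y - y' \<notin> \<int>"
  shows "of_nat a + of_rat y + 1 \<noteq> (of_nat b + of_rat y' + 1 :: 'a::field_char_0)"
proof
  assume "of_nat a + of_rat y + 1 = (of_nat b + of_rat y' + 1 :: 'a)"
  then have "of_rat (of_nat a + y) = (of_rat (of_nat b + y') :: 'a)" by (simp add: of_rat_add)
  then have "of_nat a + y = of_nat b + y'" by (simp only: of_rat_eq_iff)
  then have "y - y' = of_nat b - of_nat a" by simp
  then show False using assms by simp
qed

section \<open>Order of the remainders and Hermite interpolation\<close>

locale approximation_data =
  fixes m d n :: nat and r :: "nat \<Rightarrow> nat" and \<alpha> :: "nat \<Rightarrow> 'a::field_char_0"
    and x :: "nat \<Rightarrow> rat"
  assumes \<alpha>_nonzero: "\<And>i. i \<in> {1..m} \<Longrightarrow> \<alpha> i \<noteq> 0"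
    and \<alpha>_inj: "inj_on \<alpha> {1..m}"
    and x_regular: "\<And>j. j \<in> {1..d} \<Longrightarrow> \<not> (x j \<in> \<int> \<and> x j < 0)"
    and x_diff: "\<And>i j. i \<in> {1..d} \<Longrightarrow> j \<in> {1..d} \<Longrightarrow> i \<noteq> j \<Longrightarrow> x i - x j \<notin> \<int>"
begin

abbreviation "\<rho> \<equiv> rho d r"

abbreviation G :: "'a poly" where "G \<equiv> weight_poly d r n x"

definition pole :: "nat \<Rightarrow> nat \<Rightarrow> 'a poly" where
  "pole k j = [:of_nat k + of_rat (x j) + 1, 1:]"

definition D :: "'a poly" where "D = (\<Prod>j=1..d. pole n j ^ r j)"

lemma poly_pole: "poly (pole k j) u = u + of_nat k + of_rat (x j) + 1"
  by (simp add: pole_def)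

lemma poly_pole_nonzero: "j \<in> {1..d} \<Longrightarrow> poly (pole k j) (of_nat u) \<noteq> 0"
  using shifted_rat_nonzero[OF x_regular, of j "u + k"] by (simp add: poly_pole)

lemma pole_dvd_pochhammer_poly:
  assumes "k < n"
  shows "pole k j dvd pochhammer_poly (of_rat (x j)) n"
  unfolding pochhammer_poly_def pole_def using assms by (intro dvd_smult dvd_prodI) auto

lemma poly_G_nonzero: "poly G (of_nat u) \<noteq> 0"
proof -
  have "poly (pochhammer_poly (of_rat (x j)) n) (of_nat u) \<noteq> (0::'a)" if "j \<in> {1..d}" for j
    using poly_pole_nonzero[OF that, of _ u]
    by (auto simp: pochhammer_poly_def poly_prod pole_def)
  then show ?thesis by (auto simp: weight_poly_def poly_prod)
qed

lemma poly_D_nonzero: "poly D (of_nat u) \<noteq> 0"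
  using poly_pole_nonzero by (auto simp: D_def poly_prod)

lemma degree_D: "degree D = \<rho>"
  by (simp add: D_def pole_def degree_prod_sum_eq degree_linear_power rho_def)

text \<open>
  The zeros of \<open>G\<close> are \<open>-(x\<^sub>j + 1 + k)\<close> with \<open>k < n\<close>, those of \<open>D\<close> are \<open>-(x\<^sub>j + 1 + n)\<close>. For equal
  indices \<open>j\<close> they differ since \<open>k < n\<close>, for distinct ones because the \<open>x\<^sub>j\<close> are incongruent modulo the
  integers.
\<close>

lemma comaximal_G_D: "comaximal G D"
proof -
  have lin: "comaximal [:of_nat i + of_rat (x j') + 1, 1:] (pole n j)"
    if "j \<in> {1..d}" "j' \<in> {1..d}" "i < n" for i j j'
  proof -
    have "of_nat i + of_rat (x j') + 1 \<noteq> (of_nat n + of_rat (x j) + 1 :: 'a)"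
      using that x_diff[of j' j] shifted_rats_distinct[of "x j'" "x j" i n] by (cases "j' = j") auto
    then show ?thesis unfolding pole_def by (rule comaximal_linear)
  qed
  have const: "comaximal [:c:] q" if "c \<noteq> 0" for c :: 'a and q
    unfolding comaximal_def using that
    by (intro exI[of _ "[:1 / c:]"] exI[of _ 0]) simp
  have "comaximal (pochhammer_poly (of_rat (x j')) n) (pole n j)"
    if "j \<in> {1..d}" "j' \<in> {1..d}" for j j'
  proof -
    have "pochhammer_poly (of_rat (x j')) n =
        [:1 / fact n :: 'a:] * (\<Prod>i<n. [:of_nat i + of_rat (x j') + 1, 1:])"
      by (simp add: pochhammer_poly_def)
    then show ?thesis
      using that by (simp only:) (intro comaximal_mult_left comaximal_prod_left const lin; simp)
  qed
  then have "comaximal G (pole n j)" if "j \<in> {1..d}" for j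
    unfolding weight_poly_def using that
    by (intro comaximal_prod_left comaximal_power_left) auto
  then have "comaximal D G"
    unfolding D_def by (intro comaximal_prod_left comaximal_power_left) (simp add: comaximal_commute)
  then show ?thesis by (simp add: comaximal_commute)
qed

text \<open>
  Up to the factor \<open>\<alpha>\<^sub>i\<^sup>k\<^sup>+\<^sup>1\<close>, this is \<open>\<phi>(t\<^sup>k P)\<close>, where \<open>P\<close> is the image of \<open>A\<close> under the composed
  operators \<open>S\<close>.
\<close>

abbreviation moment :: "nat \<Rightarrow> nat \<Rightarrow> nat \<Rightarrow> nat \<Rightarrow> 'a poly \<Rightarrow> 'a" where
  "moment k i j s A \<equiv>
     poly (hadamard (\<lambda>u. 1 / (of_nat u + of_nat k + of_rat (x j) + 1) ^ s)
       (hadamard (\<lambda>u. poly G (of_nat u)) A)) (\<alpha> i)"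

text \<open>
  For \<open>k < n\<close> the pole \<open>-(k + x\<^sub>j + 1)\<close> is a zero of \<open>G\<close> of order at least \<open>r\<^sub>j\<close>, so the weight is a polynomial;
  dividing out at least one factor brings its degree below the order of vanishing \<open>\<rho> n\<close> of \<open>A\<close>.
\<close>

lemma early_moments_vanish:
  assumes i: "i \<in> {1..m}" and j: "j \<in> {1..d}" and s: "1 \<le> s" "s \<le> r j" and k: "k < n"
    and A: "[:- \<alpha> i, 1:] ^ (\<rho> * n) dvd A"
  shows "moment k i j s A = 0"
proof -
  have "pole k j ^ s dvd pochhammer_poly (of_rat (x j)) n ^ r j"
    using pole_dvd_pochhammer_poly[OF k] s(2) by (rule dvd_power_le)
  also have "\<dots> dvd G"
    unfolding weight_poly_def using j by (intro dvd_prodI) auto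
  finally obtain q where q: "G = pole k j ^ s * q" by (rule dvdE)
  have "q \<noteq> 0" using q poly_G_nonzero[of 0] by auto
  then have "degree G = s + degree q"
    unfolding q by (subst degree_mult_eq) (auto simp: pole_def degree_linear_power)
  then have "degree q < \<rho> * n" using s(1) by (simp add: degree_weight_poly)
  then have "poly (hadamard (\<lambda>u. poly q (of_nat u)) A) (\<alpha> i) = 0"
    using A \<alpha>_nonzero[OF i] linear_power_dvd_iff_moments by blast
  moreover have "1 / (of_nat u + of_nat k + of_rat (x j) + 1) ^ s * poly G (of_nat u) =
      poly q (of_nat u)" for u
    using poly_pole_nonzero[OF j, of k u] by (simp add: q poly_pole)
  ultimately show ?thesis by (simp add: hadamard_hadamard)
qed

text \<open>
  After division of the coefficients by \<open>D\<close>, the hypotheses on \<open>A\<close> become vanishing moments of \<open>B\<close>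
  against \<open>D h\<close> and \<open>G D / (u + n + x\<^sub>j + 1)\<^sup>s\<close>. These span all polynomials of degree less than
  \<open>\<rho> (n + 1)\<close>, so \<open>B\<close> solves a Hermite interpolation problem with zero data, and its degree is less than the
  number of zeros imposed, counted with multiplicity.
\<close>

lemma interpolation_unique:
  assumes dvd: "\<And>i. i \<in> {1..m} \<Longrightarrow> [:- \<alpha> i, 1:] ^ (\<rho> * n) dvd A"
    and mom: "\<And>i j s. i \<in> {1..m} \<Longrightarrow> j \<in> {1..d} \<Longrightarrow> s \<in> {1..r j} \<Longrightarrow> moment n i j s A = 0"
    and deg: "A = 0 \<or> degree A < \<rho> * m * (n + 1)"
  shows "A = 0"
proof (rule ccontr)
  assume "A \<noteq> 0"
  define B where "B = hadamard (\<lambda>u. 1 / poly D (of_nat u)) A"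
  have "[:- \<alpha> i, 1:] ^ (\<rho> * (n + 1)) dvd B" if i: "i \<in> {1..m}" for i
  proof -
    \<comment> \<open>The weights whose moment of \<open>B\<close> at \<open>\<alpha> i\<close> vanishes.\<close>
    define W where "W = {p. poly (hadamard (\<lambda>u. poly p (of_nat u)) B) (\<alpha> i) = 0}"
    have add: "hadamard (\<lambda>u. poly (p + q) (of_nat u)) B =
        hadamard (\<lambda>u. poly p (of_nat u)) B + hadamard (\<lambda>u. poly q (of_nat u)) B" for p q
      by (rule poly_eqI) (simp add: algebra_simps)
    have scale: "hadamard (\<lambda>u. poly (smult c p) (of_nat u)) B =
        smult c (hadamard (\<lambda>u. poly p (of_nat u)) B)" for c p
      by (rule poly_eqI) (simp add: algebra_simps)
    have W: "poly_subspace W"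
      unfolding poly_subspace_def W_def
      by (auto simp only: mem_Collect_eq add scale) (simp_all add: hadamard_def)
    have D_in: "D * h \<in> W" if "h = 0 \<or> degree h < \<rho> * n" for h
    proof (cases "h = 0")
      case True
      then show ?thesis using W by (simp add: poly_subspace_def)
    next
      case False
      have "hadamard (\<lambda>u. poly (D * h) (of_nat u)) B = hadamard (\<lambda>u. poly h (of_nat u)) A"
        by (rule poly_eqI) (simp add: B_def poly_D_nonzero)
      moreover have "poly (hadamard (\<lambda>u. poly h (of_nat u)) A) (\<alpha> i) = 0"
        using False that dvd[OF i] \<alpha>_nonzero[OF i] linear_power_dvd_iff_moments by blast
      ultimately show ?thesis by (simp add: W_def)
    qed
    have G_in: "G * (pole n j ^ k * (\<Prod>j'\<in>{1..d} - {j}. pole n j' ^ r j')) \<in> W"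
      if j: "j \<in> {1..d}" and k: "k < r j" for j k
    proof -
      define s where "s = r j - k"
      define q where "q = pole n j ^ k * (\<Prod>j'\<in>{1..d} - {j}. pole n j' ^ r j')"
      have "D = pole n j ^ r j * (\<Prod>j'\<in>{1..d} - {j}. pole n j' ^ r j')"
        unfolding D_def using j by (intro prod.remove) auto
      also have "r j = s + k" using k by (simp add: s_def)
      finally have Dq: "D = pole n j ^ s * q" by (simp add: q_def power_add mult.assoc)
      have qv: "poly q (of_nat u) / poly D (of_nat u) =
          1 / (of_nat u + of_nat n + of_rat (x j) + 1) ^ s" for u
        using poly_D_nonzero[of u] by (simp add: Dq poly_pole)
      have "hadamard (\<lambda>u. poly (G * q) (of_nat u)) B =
          hadamard (\<lambda>u. 1 / (of_nat u + of_nat n + of_rat (x j) + 1) ^ s)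
            (hadamard (\<lambda>u. poly G (of_nat u)) A)"
        by (rule poly_eqI) (simp add: B_def flip: qv)
      moreover have "moment n i j s A = 0"
        using k by (intro mom i j) (auto simp: s_def)
      ultimately show ?thesis by (simp add: W_def q_def)
    qed
    have "f \<in> W" if f: "degree f < \<rho> * (n + 1)" for f
    proof -
      have nz: "G \<noteq> 0" "D \<noteq> 0" using poly_G_nonzero[of 0] poly_D_nonzero[of 0] by auto
      obtain g h where gh: "f = g * G + h * D"
        and g: "g = 0 \<or> degree g < \<rho>" and h: "h = 0 \<or> degree h < \<rho> * n"
        using comaximal_decomposition[OF comaximal_G_D nz, of f] f
        by (auto simp: degree_D degree_weight_poly)
      have inj: "inj_on (\<lambda>j. of_nat n + of_rat (x j) + 1 :: 'a) {1..d}"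
        using shifted_rats_distinct[OF x_diff, of _ _ n n] by (fastforce intro: inj_onI)
      have "g \<in> {g. G * g \<in> W}"
      proof (rule mem_subspace_of_partial_fractions[OF _ inj poly_subspace_quotient[OF W]])
        show "g = 0 \<or> degree g < sum r {1..d}" using g by (simp add: rho_def)
      qed (use G_in in \<open>simp_all add: pole_def\<close>)
      then show ?thesis
        using D_in[OF h] W unfolding gh poly_subspace_def
        by (metis mem_Collect_eq mult.commute)
    qed
    then show ?thesis
      unfolding linear_power_dvd_iff_moments[OF \<alpha>_nonzero[OF i]] W_def by simp
  qed
  moreover have "inj_on (\<lambda>i. - \<alpha> i) {1..m}"
    by (rule inj_onI) (use \<alpha>_inj in \<open>auto dest: inj_onD\<close>)
  ultimately have prod: "(\<Prod>i\<in>{1..m}. [:- \<alpha> i, 1:] ^ (\<rho> * (n + 1))) dvd B"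
    by (rule prod_linear_powers_dvd[OF finite_atLeastAtMost, rotated])
  have "coeff B (degree A) \<noteq> 0"
    using \<open>A \<noteq> 0\<close> poly_D_nonzero by (simp add: B_def)
  then have "B \<noteq> 0" by auto
  have "m * (\<rho> * (n + 1)) \<le> degree B"
    using dvd_imp_degree_le[OF prod \<open>B \<noteq> 0\<close>] by (simp add: degree_prod_sum_eq degree_linear_power)
  also have "\<dots> \<le> degree A" unfolding B_def by (rule degree_hadamard_le)
  finally show False using deg \<open>A \<noteq> 0\<close> by (simp add: algebra_simps)
qed

lemma A_poly_dvd:
  assumes "i \<in> {1..m}"
  shows "[:- \<alpha> i, 1:] ^ (\<rho> * n) dvd A_poly m d r n \<alpha> l"
  unfolding A_poly_def using assms by (intro dvd_mult dvd_prodI) auto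

lemma degree_A_poly: "degree (A_poly m d r n \<alpha> l) = l + \<rho> * n * m"
  unfolding A_poly_def
  by (subst degree_mult_eq) (auto simp: degree_monom_eq degree_prod_sum_eq degree_linear_power)

lemma degree_P_poly: "degree (P_poly m d r n \<alpha> x l) \<le> l + \<rho> * n * m"
  using degree_hadamard_le[of _ "A_poly m d r n \<alpha> l"]
  by (simp add: P_poly_eq_hadamard degree_A_poly)

text \<open>
  The remainder starts with degree at most \<open>b + n\<close>, and its \<open>n\<close> top coefficients are the moments
  that vanish.
\<close>

lemma remainder_top:
  assumes "i \<in> {1..m}" and "j \<in> {1..d}" and "s \<in> {1..r j}" and "l \<le> \<rho> * m"
  defines "b \<equiv> \<rho> * m * (n + 1)"
  defines "R \<equiv> remainder (\<alpha> i) (x j) s (b + n) (P_poly m d r n \<alpha> x l)"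
  shows "degree R \<le> b" and "coeff R b = \<alpha> i ^ (n + 1) * moment n i j s (A_poly m d r n \<alpha> l)"
proof -
  have deg: "degree (P_poly m d r n \<alpha> x l) \<le> b"
    using degree_P_poly[of l] assms(4) by (simp add: b_def algebra_simps)
  have coeff: "coeff R (b + n - k) = \<alpha> i ^ (k + 1) * moment k i j s (A_poly m d r n \<alpha> l)"
    if "k \<le> n" for k
    unfolding R_def using that deg
    by (subst coeff_remainder) (simp_all add: P_poly_eq_hadamard)
  show "coeff R b = \<alpha> i ^ (n + 1) * moment n i j s (A_poly m d r n \<alpha> l)"
    using coeff[of n] by simp
  have "coeff R q = 0" if "b < q" for q
  proof (cases "q \<le> b + n")
    case True
    have k: "b + n - q < n" "b + n - (b + n - q) = q" using that True by auto
    have "moment (b + n - q) i j s (A_poly m d r n \<alpha> l) = 0"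
      using assms(1-3) k A_poly_dvd by (intro early_moments_vanish) auto
    then show ?thesis using coeff[of "b + n - q"] k by simp
  next
    case False
    have "degree R \<le> b + n"
      unfolding R_def using deg by (intro degree_remainder_le) simp
    then show ?thesis using False by (simp add: coeff_eq_0)
  qed
  then show "degree R \<le> b" by (intro degree_le) blast
qed

text \<open>
  The vanishing of the coefficient at the top degree brings the combination of the
  \<open>A\<^sub>l\<close> down to the degree needed for \<open>interpolation_unique\<close>.
\<close>

lemma combination_unique:
  assumes top: "(\<Sum>l\<le>\<rho> * m. v l * coeff (A_poly m d r n \<alpha> l) (\<rho> * m * (n + 1))) = 0"
    and mom: "\<And>i j s. i \<in> {1..m} \<Longrightarrow> j \<in> {1..d} \<Longrightarrow> s \<in> {1..r j} \<Longrightarrow>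
      (\<Sum>l\<le>\<rho> * m. v l * moment n i j s (A_poly m d r n \<alpha> l)) = 0"
    and l: "l \<le> \<rho> * m"
  shows "v l = 0"
proof -
  define A where "A = (\<Sum>l\<le>\<rho> * m. smult (v l) (A_poly m d r n \<alpha> l))"
  have "degree A \<le> \<rho> * m * (n + 1)"
    unfolding A_def
    by (intro degree_sum_le) (auto intro!: order.trans[OF degree_smult_le] simp: degree_A_poly algebra_simps)
  moreover have "coeff A (\<rho> * m * (n + 1)) = 0"
    using top by (simp add: A_def coeff_sum)
  ultimately have deg: "A = 0 \<or> degree A < \<rho> * m * (n + 1)"
    by (metis le_neq_implies_less leading_coeff_0_iff)
  have "moment n i j s A = 0" if "i \<in> {1..m}" "j \<in> {1..d}" "s \<in> {1..r j}" for i j s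
    using mom[OF that] by (simp add: A_def hadamard_smult_sum poly_sum)
  moreover have "[:- \<alpha> i, 1:] ^ (\<rho> * n) dvd A" if "i \<in> {1..m}" for i
    unfolding A_def using A_poly_dvd[OF that] by (intro dvd_sum dvd_smult)
  ultimately have "A = 0" using deg interpolation_unique by blast
  moreover have "A = (\<Sum>l\<le>\<rho> * m. monom (v l) l) * (\<Prod>i=1..m. [:- \<alpha> i, 1:] ^ (\<rho> * n))"
    unfolding A_def A_poly_def sum_distrib_right
    by (intro sum.cong refl) (simp add: smult_monom mult_smult_left[symmetric] del: mult_smult_left)
  moreover have "(\<Prod>i=1..m. [:- \<alpha> i, 1:] ^ (\<rho> * n)) \<noteq> 0" by simp
  ultimately have "(\<Sum>l\<le>\<rho> * m. monom (v l) l) = 0" by simp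
  then have "coeff (\<Sum>l\<le>\<rho> * m. monom (v l) l) l = 0" by simp
  then show ?thesis using l by (simp add: coeff_sum)
qed

end

section \<open>The determinant\<close>

theorem proposition4p1:
  fixes \<alpha> :: "nat \<Rightarrow> 'a::field_char_0" and x :: "nat \<Rightarrow> rat" and r :: "nat \<Rightarrow> nat"
    and m d n :: nat and e :: "nat \<Rightarrow> nat \<times> nat \<times> nat"
  assumes "m \<ge> 1" and "d \<ge> 1" and "n \<ge> 1"
    and "\<And>j. j \<in> {1..d} \<Longrightarrow> r j \<ge> 1"
    and "\<And>i. i \<in> {1..m} \<Longrightarrow> \<alpha> i \<noteq> 0"
    and "inj_on \<alpha> {1..m}"
    and "\<And>j. j \<in> {1..d} \<Longrightarrow> \<not> (x j \<in> \<int> \<and> x j < 0)"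
    and "\<And>i j. i \<in> {1..d} \<Longrightarrow> j \<in> {1..d} \<Longrightarrow> i \<noteq> j \<Longrightarrow> x i - x j \<notin> \<int>"
    and "bij_betw e {1..rho d r * m} (idx_set m d r)"
  shows "\<exists>c. c \<noteq> 0 \<and> Delta m d r n \<alpha> x e = [:c:]"
proof -
  interpret approximation_data m d n r \<alpha> x
    using assms(5-8) by unfold_locales
  define R where "R = \<rho> * m"
  define b where "b = \<rho> * m * (n + 1)"
  define P where "P = P_poly m d r n \<alpha> x"
  define A where "A = A_poly m d r n \<alpha>"
  define f where
    "f k = (case e k of (i, j, s) \<Rightarrow> \<Sum>q\<le>b + n. monom (phi (\<alpha> i) (x j) s (monom 1 q)) (b + n - q))" for k
  define rem where "rem k l = (case e k of (i, j, s) \<Rightarrow> remainder (\<alpha> i) (x j) s (b + n) (P l))" for k l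
  define T where "T = mat_of_cols (R + 1) (map (p_vec m d r n \<alpha> x e) [0..<R + 1])"
  \<comment> \<open>The row operations: keep row 0, and replace each other row by its remainder.\<close>
  define E where "E = mat (R + 1) (R + 1) (\<lambda>(k, c). if k = 0 then (if c = 0 then 1 else 0)
    else if c = 0 then f k else if c = k then - monom 1 (Suc (b + n)) else 0)"
  have carrier: "T \<in> carrier_mat (R + 1) (R + 1)" "E \<in> carrier_mat (R + 1) (R + 1)"
    unfolding T_def E_def by (auto simp: mat_of_cols_def)
  have e_idx: "e k \<in> idx_set m d r" if "k \<noteq> 0" "k \<le> R" for k
    using bij_betwE[OF assms(9)] that by (auto simp: R_def)
  have entry: "(E * T) $$ (k, l) = (if k = 0 then P l else rem k l)" if kl: "k < R + 1" "l < R + 1" for k l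
  proof -
    define w where "w c = p_vec m d r n \<alpha> x e l $ c" for c
    have w0: "w 0 = P l" by (simp add: w_def p_vec_def P_def)
    have w: "w k = P_aux m d r n \<alpha> x l (e k)" if "k \<noteq> 0"
      using kl that by (simp add: w_def p_vec_def R_def)
    have "T $$ (c, l) = w c" if "c < R + 1" for c
      using that kl unfolding T_def w_def by (subst mat_of_cols_index) (auto simp del: upt_Suc)
    then have "(E * T) $$ (k, l) = (\<Sum>c=0..<R + 1. E $$ (k, c) * w c)"
      using carrier kl by (auto simp: scalar_prod_def intro!: sum.cong)
    also have "\<dots> = E $$ (k, 0) * w 0 + (\<Sum>c=1..<R + 1. E $$ (k, c) * w c)"
      by (subst sum.atLeast_Suc_lessThan) auto
    also have "(\<Sum>c=1..<R + 1. E $$ (k, c) * w c) =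
        (\<Sum>c=1..<R + 1. if c = k then - monom 1 (Suc (b + n)) * w k else 0)"
      using kl by (intro sum.cong refl) (auto simp: E_def)
    also have "\<dots> = (if k = 0 then 0 else - monom 1 (Suc (b + n)) * w k)"
      using kl by (subst sum.delta) auto
    also have "E $$ (k, 0) * w 0 + \<dots> = (if k = 0 then P l else rem k l)"
      using kl w w0
      by (auto simp: E_def rem_def f_def remainder_def P_aux_def P_def split: prod.split)
    finally show ?thesis .
  qed
  have deg: "degree ((E * T) $$ (k, l)) \<le> b" if kl: "k < R + 1" "l < R + 1" for k l
  proof (cases "k = 0")
    case True
    then show ?thesis
      using kl degree_P_poly[of l] by (simp add: entry P_def R_def b_def algebra_simps)
  next
    case False
    then show ?thesis
      using kl e_idx[of k] remainder_top(1)
      by (auto simp: entry rem_def idx_set_def P_def R_def b_def split: prod.split)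
  qed
  \<comment> \<open>The entries of \<open>E * T\<close> have degree at most \<open>b\<close>, so \<open>det C\<close> is the coefficient of \<open>det (E * T)\<close>
      at the degree bound \<open>b * (R + 1)\<close>.\<close>
  define C where "C = map_mat (\<lambda>p. coeff p b) (E * T)"
  have C: "C \<in> carrier_mat (R + 1) (R + 1)" using carrier by (auto simp: C_def)
  have "det C \<noteq> 0"
  proof
    assume "det C = 0"
    then obtain v where v: "v \<in> carrier_vec (R + 1)" "v \<noteq> 0\<^sub>v (R + 1)" "C *\<^sub>v v = 0\<^sub>v (R + 1)"
      using det_0_iff_vec_prod_zero_field[OF C] by blast
    have row: "(\<Sum>l\<le>R. v $ l * coeff ((E * T) $$ (k, l)) b) = 0" if "k < R + 1" for k
    proof -
      have "(C *\<^sub>v v) $ k = 0" using v(3) that by simp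
      then show ?thesis
        using that C v(1) carrier
        by (auto simp: scalar_prod_def C_def atLeast0LessThan lessThan_Suc_atMost mult.commute)
    qed
    have "v $ l = 0" if "l \<le> R" for l
    proof (rule combination_unique[of "\<lambda>l. v $ l"])
      have "(\<Sum>l\<le>R. v $ l * (poly G (of_nat b) * coeff (A l) b)) = 0"
        using row[of 0] by (simp add: entry P_def P_poly_eq_hadamard A_def)
      then have "poly G (of_nat b) * (\<Sum>l\<le>R. v $ l * coeff (A l) b) = 0"
        by (simp add: sum_distrib_left mult.left_commute)
      then show "(\<Sum>l\<le>\<rho> * m. v $ l * coeff (A_poly m d r n \<alpha> l) (\<rho> * m * (n + 1))) = 0"
        using poly_G_nonzero[of b] by (simp add: R_def b_def A_def)
    next
      fix i j s
      assume ijs: "i \<in> {1..m}" "j \<in> {1..d}" "s \<in> {1..r j}"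
      then have "(i, j, s) \<in> e ` {1..R}"
        using bij_betw_imp_surj_on[OF assms(9)] by (auto simp: R_def idx_set_def)
      then obtain k where k: "e k = (i, j, s)" "k \<noteq> 0" "k < R + 1" by auto
      have "(\<Sum>l\<le>R. v $ l * (\<alpha> i ^ (n + 1) * moment n i j s (A l))) = 0"
        using row[OF k(3)] k remainder_top(2)[OF ijs]
        by (simp add: entry rem_def P_def A_def R_def b_def)
      then have "\<alpha> i ^ (n + 1) * (\<Sum>l\<le>R. v $ l * moment n i j s (A l)) = 0"
        by (simp add: sum_distrib_left mult.left_commute)
      then show "(\<Sum>l\<le>\<rho> * m. v $ l * moment n i j s (A_poly m d r n \<alpha> l)) = 0"
        using assms(5)[OF ijs(1)] by (simp add: R_def A_def)
    qed (use that in \<open>simp add: R_def\<close>)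
    then have "v = 0\<^sub>v (R + 1)" using v(1) by (intro eq_vecI) auto
    with v(2) show False by simp
  qed
  then have top: "coeff (det (E * T)) (b * (R + 1)) \<noteq> 0"
    and bound: "degree (det (E * T)) \<le> b * (R + 1)"
    using det_degree_and_coeff[of "E * T" "R + 1" b] deg carrier by (auto simp: C_def)
  \<comment> \<open>\<open>E\<close> is lower triangular; its determinant is \<open>\<plusminus> z\<close> to exactly the degree bound for \<open>det (E * T)\<close>.\<close>
  have "det E = prod_list (diag_mat E)"
    by (rule det_lower_triangular[OF _ carrier(2)]) (auto simp: E_def)
  also have "diag_mat E = 1 # replicate R (- monom 1 (Suc (b + n)))"
    by (rule nth_equalityI) (auto simp: diag_mat_def E_def nth_Cons simp del: upt_Suc split: nat.split)
  finally have "det E = (- monom 1 (Suc (b + n))) ^ R" by simp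
  also have "\<dots> = monom ((- 1) ^ R) (b * (R + 1))"
    by (simp add: minus_monom monom_power b_def R_def algebra_simps)
  finally have det: "det (E * T) = monom ((- 1) ^ R) (b * (R + 1)) * Delta m d r n \<alpha> x e"
    using det_mult[OF carrier(2,1)] by (simp add: T_def Delta_def R_def)
  have c: "coeff (Delta m d r n \<alpha> x e) 0 \<noteq> 0"
    using top by (simp add: det coeff_monom_mult)
  then have "degree (det (E * T)) = b * (R + 1) + degree (Delta m d r n \<alpha> x e)"
    unfolding det by (subst degree_mult_eq) (auto simp: degree_monom_eq)
  then have "degree (Delta m d r n \<alpha> x e) = 0" using bound by simp
  then obtain c where "Delta m d r n \<alpha> x e = [:c:]" by (rule degree_eq_zeroE)
  with c show ?thesis by auto
qed

end
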